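(* Let $h:\mathrm{St}(r,n,\mathbb{C})\to\mathbb{R}$ be a $C^2$ unitarily invariant function and let $U$ be a stationary point of $h$. For $1\le p<q\le r$ let $\Omega_{p,q}=\mathrm{i}(e_pe_q^{T}+e_qe_p^{T})$, $\Omega'_{p,q}=e_pe_q^{T}-e_qe_p^{T}$, $Z_{p,q}=U\Omega_{p,q}$ and $Z'_{p,q}=U\Omega'_{p,q}$. Then $\mathrm{Hess}\,h(U)[Z_{p,q}]=0$ and $\mathrm{Hess}\,h(U)[Z'_{p,q}]=0$ for all $1\le p<q\le r$. In particular, $\mathrm{rank}\,\mathrm{Hess}\,h(U)\le 2r(n-r)$.
   Context: For $1\le r\le n$, $\mathrm{St}(r,n,\mathbb{C})=\{X\in\mathbb{C}^{n\times r}:X^{H}X=I_r\}$, viewed as a Riemannian submanifold (of real dimension $2nr-r^2$) of the real Euclidean space $\mathbb{C}^{n\times r}$ with inner product $\langle X,Y\rangle_{\Re}=\Re\,\mathrm{tr}(X^{H}Y)$. $U$ is a stationary point of $h$ if the Riemannian gradient of $h$ vanishes at $U$. $\mathrm{Hess}\,h(U)$ is the Riemannian Hessian, a real-linear self-map of the tangent space at $U$; rank means real rank. $h$ is unitarily invariant if $h(UR)=h(U)$ for all $U$ and all unitary $R\in\mathbb{C}^{r\times r}$. $e_p\in\mathbb{R}^r$ is the $p$-th standard unit vector and $\mathrm{i}$ the imaginary unit. *)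

theory Defs
  imports "HOL-Analysis.Analysis"
begin

section \<open>Embedded submanifolds of a Euclidean space\<close>

text \<open>
  A submanifold \<open>M\<close> is represented by its underlying set, with the Riemannian metric induced by the
  ambient inner product; functions and vector fields on \<open>M\<close> are total functions whose values outside
  \<open>M\<close> are irrelevant.
\<close>

definition C2_on :: "('a::euclidean_space \<Rightarrow> real) \<Rightarrow> 'a set \<Rightarrow> bool" where
  "C2_on f S \<longleftrightarrow>
    (\<exists>(f' :: 'a \<Rightarrow> 'a \<Rightarrow>\<^sub>L real) (f'' :: 'a \<Rightarrow> 'a \<Rightarrow>\<^sub>L ('a \<Rightarrow>\<^sub>L real)).
      (\<forall>x\<in>S. (f has_derivative blinfun_apply (f' x)) (at x)) \<and>
      (\<forall>x\<in>S. (f' has_derivative blinfun_apply (f'' x)) (at x)) \<and>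
      continuous_on S f'')"

definition C2_on_submanifold :: "'a::euclidean_space set \<Rightarrow> ('a \<Rightarrow> real) \<Rightarrow> bool" where
  "C2_on_submanifold M h \<longleftrightarrow>
    (\<forall>x\<in>M. \<exists>V hbar. open V \<and> x \<in> V \<and> C2_on hbar V \<and> (\<forall>y\<in>V \<inter> M. hbar y = h y))"

definition curve_at :: "'a::euclidean_space set \<Rightarrow> 'a \<Rightarrow> 'a \<Rightarrow> (real \<Rightarrow> 'a) \<Rightarrow> bool" where
  "curve_at M x v c \<longleftrightarrow>
    (\<exists>\<epsilon>>0. c C1_differentiable_on {-\<epsilon><..<\<epsilon>} \<and> c ` {-\<epsilon><..<\<epsilon>} \<subseteq> M) \<and>
    c 0 = x \<and> (c has_vector_derivative v) (at 0)"

definition tangent_space :: "'a::euclidean_space set \<Rightarrow> 'a \<Rightarrow> 'a set" where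
  "tangent_space M x = {v. \<exists>c. curve_at M x v c}"

definition orth_proj :: "'a::euclidean_space set \<Rightarrow> 'a \<Rightarrow> 'a" where
  "orth_proj T x = (THE y. y \<in> T \<and> (\<forall>t\<in>T. (x - y) \<bullet> t = 0))"

text \<open>The tangent vector \<open>g\<close> with \<open>\<langle>g, v\<rangle> = Dh(x)[v]\<close> for all tangent vectors \<open>v\<close>, where \<open>Dh(x)[v]\<close>
  is the derivative of \<open>h\<close> along any curve in \<open>M\<close> through \<open>x\<close> with velocity \<open>v\<close>.\<close>

definition riem_grad :: "'a::euclidean_space set \<Rightarrow> ('a \<Rightarrow> real) \<Rightarrow> 'a \<Rightarrow> 'a" where
  "riem_grad M h x =
    (THE g. g \<in> tangent_space M x \<and>
      (\<forall>v c. curve_at M x v c \<longrightarrow> ((\<lambda>t. h (c t)) has_real_derivative (g \<bullet> v)) (at 0)))"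

text \<open>The derivative \<open>D F(x)[v]\<close>, in the ambient space, of a vector field \<open>F\<close> given on \<open>M\<close>,
  in a tangent direction \<open>v\<close>.\<close>

definition deriv_along ::
    "'a::euclidean_space set \<Rightarrow> ('a \<Rightarrow> 'a) \<Rightarrow> 'a \<Rightarrow> 'a \<Rightarrow> 'a" where
  "deriv_along M F x v =
    (THE w. \<forall>c. curve_at M x v c \<longrightarrow> ((\<lambda>t. F (c t)) has_vector_derivative w) (at 0))"

text \<open>\<open>Hess h(x)[v]\<close> is the covariant derivative of the gradient field in direction \<open>v\<close>. The
  Levi-Civita connection of a Riemannian submanifold is the tangential part of the ambient
  derivative. Only \<open>v \<in> tangent_space M x\<close> is meaningful.\<close>

definition riem_hess ::
    "'a::euclidean_space set \<Rightarrow> ('a \<Rightarrow> real) \<Rightarrow> 'a \<Rightarrow> 'a \<Rightarrow> 'a" where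
  "riem_hess M h x v = orth_proj (tangent_space M x) (deriv_along M (riem_grad M h) x v)"

definition stationary_point :: "'a::euclidean_space set \<Rightarrow> ('a \<Rightarrow> real) \<Rightarrow> 'a \<Rightarrow> bool" where
  "stationary_point M h x \<longleftrightarrow> x \<in> M \<and> riem_grad M h x = 0"

lemma orth_proj_eqI:
  assumes "subspace T" "y \<in> T" "\<And>t. t \<in> T \<Longrightarrow> (x - y) \<bullet> t = 0"
  shows "orth_proj T x = y"
  unfolding orth_proj_def
proof (rule the_equality)
  fix z assume z: "z \<in> T \<and> (\<forall>t\<in>T. (x - z) \<bullet> t = 0)"
  then have "z - y \<in> T"
    using assms by (simp add: subspace_diff)
  then have "(x - z) \<bullet> (z - y) = 0" "(x - y) \<bullet> (z - y) = 0"
    using z assms(3) by auto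
  then have "(z - y) \<bullet> (z - y) = 0"
    by (simp add: inner_diff_left)
  then show "z = y" by simp
qed (use assms in auto)

lemma riem_grad_eqI:
  assumes "subspace (tangent_space M x)" "g \<in> tangent_space M x"
    and "\<And>v c. curve_at M x v c \<Longrightarrow> ((\<lambda>t. h (c t)) has_real_derivative (g \<bullet> v)) (at 0)"
  shows "riem_grad M h x = g"
  unfolding riem_grad_def
proof (rule the_equality)
  fix g' assume g': "g' \<in> tangent_space M x \<and>
      (\<forall>v c. curve_at M x v c \<longrightarrow> ((\<lambda>t. h (c t)) has_real_derivative (g' \<bullet> v)) (at 0))"
  then have "g' - g \<in> tangent_space M x"
    using assms by (simp add: subspace_diff)
  then obtain c where "curve_at M x (g' - g) c"
    by (auto simp: tangent_space_def)
  then have "g' \<bullet> (g' - g) = g \<bullet> (g' - g)"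
    using g' assms(3) DERIV_unique by blast
  then have "(g' - g) \<bullet> (g' - g) = 0"
    by (simp add: inner_diff_left)
  then show "g' = g" by simp
qed (use assms in auto)

section \<open>The complex Stiefel manifold\<close>

text \<open>\<open>complex ^ 'r ^ 'n\<close> is the space of matrices with rows indexed by \<open>'n\<close> and columns by \<open>'r\<close>.\<close>

definition conj_transpose :: "complex ^ 'r ^ 'n \<Rightarrow> complex ^ 'n ^ 'r" where
  "conj_transpose A = (\<chi> i j. cnj (A $ j $ i))"

definition stiefel :: "(complex ^ 'r ^ 'n) set" where
  "stiefel = {X. conj_transpose X ** X = mat 1}"

definition unitary_matrix :: "complex ^ 'r ^ 'r \<Rightarrow> bool" where
  "unitary_matrix R \<longleftrightarrow> conj_transpose R ** R = mat 1 \<and> R ** conj_transpose R = mat 1"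

definition unitarily_invariant :: "(complex ^ 'r ^ 'n \<Rightarrow> real) \<Rightarrow> bool" where
  "unitarily_invariant h \<longleftrightarrow> (\<forall>U\<in>stiefel. \<forall>R. unitary_matrix R \<longrightarrow> h (U ** R) = h U)"

text \<open>The library's inner product is the one used on the ambient space.\<close>

lemma inner_eq_Re_trace:
  fixes X Y :: "complex ^ 'r ^ 'n"
  shows "X \<bullet> Y = Re (trace (conj_transpose X ** Y))"
proof -
  have "X \<bullet> Y = (\<Sum>i\<in>UNIV. \<Sum>j\<in>UNIV. Re (cnj (X $ i $ j) * Y $ i $ j))"
    by (simp add: inner_vec_def inner_complex_def)
  also have "\<dots> = (\<Sum>j\<in>UNIV. \<Sum>i\<in>UNIV. Re (cnj (X $ i $ j) * Y $ i $ j))"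
    by (rule sum.swap)
  also have "\<dots> = Re (trace (conj_transpose X ** Y))"
    by (simp add: trace_def matrix_matrix_mult_def conj_transpose_def)
  finally show ?thesis .
qed

definition outer :: "complex ^ 'r \<Rightarrow> complex ^ 'r \<Rightarrow> complex ^ 'r ^ 'r" where
  "outer x y = (\<chi> i j. x $ i * y $ j)"

definition Omega :: "'r \<Rightarrow> 'r \<Rightarrow> complex ^ 'r ^ 'r" where
  "Omega p q = map_matrix ((*) \<i>) (outer (axis p 1) (axis q 1) + outer (axis q 1) (axis p 1))"

definition Omega' :: "'r \<Rightarrow> 'r \<Rightarrow> complex ^ 'r ^ 'r" where
  "Omega' p q = outer (axis p 1) (axis q 1) - outer (axis q 1) (axis p 1)"

end

theory Submission
  imports Defs
begin

text \<open>
  A unitarily invariant \<open>h\<close> is constant along the orbit \<open>{U R | R unitary}\<close>, and right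
  multiplication by \<open>R\<close> is a linear isometry of the Stiefel manifold. So if \<open>U\<close> is stationary, every
  point \<open>U R\<close> is (\<open>stationary_point_unitary_orbit\<close>): the gradient field vanishes along the whole
  orbit. Differentiating it along a curve \<open>U A(t)\<close> with \<open>A(t)\<close> unitary, \<open>A(0) = I\<close> and \<open>A'(0) = S\<close>
  gives \<open>0\<close>, so the Hessian kills \<open>U S\<close> for every skew-Hermitian \<open>S\<close> (\<open>riem_hess_vertical\<close>). The
  matrices \<open>\<Omega>\<close> and \<open>\<Omega>'\<close> are skew-Hermitian.

  For the rank, split a tangent vector as \<open>v = U (U\<^sup>H v) + (v - U U\<^sup>H v)\<close>. The factor \<open>U\<^sup>H v\<close> is
  skew-Hermitian, so the first summand is in the kernel, and the image of the Hessian is the image of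
  the horizontal space \<open>{V. U\<^sup>H V = 0}\<close>. This space meets the range of the injection \<open>A \<mapsto> U A\<close> only
  in \<open>0\<close>, hence has real dimension at most \<open>2 n r - 2 r\<^sup>2\<close>.

  Most of the work is in making the intrinsic definitions, which are phrased by curves and definite
  descriptions, computable. The tangent space at \<open>X\<close> consists of the \<open>V\<close> with \<open>X\<^sup>H V\<close> skew-Hermitian;
  this needs enough curves, which come from Cayley transforms (\<open>unitary_curve\<close>). The orthogonal
  projection onto it has a closed form, polynomial in \<open>X\<close>, so near \<open>U\<close> the Riemannian gradient is the
  restriction of a differentiable ambient field: the projected gradient of a local \<open>C\<^sup>2\<close> extension.
  The chain rule then makes its derivative along curves well defined and linear in the velocity.
\<close>

section \<open>Matrix algebra\<close>

interpretation matmul: bounded_bilinear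
  "(**) :: complex ^ 'b::finite ^ 'a::finite \<Rightarrow> complex ^ 'c::finite ^ 'b \<Rightarrow> complex ^ 'c ^ 'a"
  unfolding bilinear_conv_bounded_bilinear[symmetric] bilinear_def linear_iff
  by (auto simp: matrix_matrix_mult_def vec_eq_iff algebra_simps sum.distrib scaleR_right.sum)

lemma bounded_linear_conj_transpose:
  "bounded_linear (conj_transpose :: complex ^ 'b::finite ^ 'a::finite \<Rightarrow> complex ^ 'a ^ 'b)"
  unfolding linear_conv_bounded_linear[symmetric] linear_iff
  by (auto simp: conj_transpose_def vec_eq_iff)

lemmas conj_transpose_linear_simps =
  linear_add[OF bounded_linear.linear[OF bounded_linear_conj_transpose]]
  linear_diff[OF bounded_linear.linear[OF bounded_linear_conj_transpose]]
  linear_neg[OF bounded_linear.linear[OF bounded_linear_conj_transpose]]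
  linear_cmul[OF bounded_linear.linear[OF bounded_linear_conj_transpose]]

lemmas matrix_linear_simps = conj_transpose_linear_simps
  matmul.add_left matmul.add_right matmul.diff_left matmul.diff_right
  matmul.scaleR_left matmul.scaleR_right matmul.minus_left matmul.minus_right

lemma conj_transpose_conj_transpose [simp]: "conj_transpose (conj_transpose A) = A"
  by (simp add: conj_transpose_def vec_eq_iff)

lemma conj_transpose_mat_1 [simp]: "conj_transpose (mat 1) = mat 1"
  by (auto simp: conj_transpose_def mat_def vec_eq_iff)

lemma conj_transpose_mult:
  "conj_transpose (A ** B) = conj_transpose B ** conj_transpose A"
  by (simp add: conj_transpose_def matrix_matrix_mult_def vec_eq_iff mult.commute)

lemma inner_mult_left_adjoint:
  fixes A :: "complex ^ 'b::finite ^ 'a::finite"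
  shows "(A ** B) \<bullet> C = B \<bullet> (conj_transpose A ** C)"
  by (simp add: inner_eq_Re_trace conj_transpose_mult matrix_mul_assoc)

lemma inner_conj_transpose:
  fixes A B :: "complex ^ 'b::finite ^ 'a::finite"
  shows "conj_transpose A \<bullet> conj_transpose B = A \<bullet> B"
proof -
  have "conj_transpose A \<bullet> conj_transpose B
      = (\<Sum>j\<in>UNIV. \<Sum>i\<in>UNIV. A $ i $ j \<bullet> B $ i $ j)"
    by (simp add: inner_vec_def inner_complex_def conj_transpose_def)
  also have "\<dots> = A \<bullet> B"
    unfolding inner_vec_def by (rule sum.swap)
  finally show ?thesis .
qed

lemma inner_hermitian_skew:
  fixes H S :: "complex ^ 'a::finite ^ 'a"
  assumes "conj_transpose H = H" "conj_transpose S = - S"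
  shows "H \<bullet> S = 0"
  using inner_conj_transpose[of H S] assms by simp

lemma stiefel_cancel:
  assumes "X \<in> stiefel"
  shows "conj_transpose X ** (X ** Y) = Y"
  using assms by (simp add: stiefel_def matrix_mul_assoc)

lemma stiefel_mult:
  assumes "X \<in> stiefel" "Y \<in> stiefel"
  shows "X ** Y \<in> stiefel"
proof -
  have "conj_transpose (X ** Y) ** (X ** Y) = conj_transpose Y ** (conj_transpose X ** (X ** Y))"
    by (simp add: conj_transpose_mult matrix_mul_assoc)
  then show ?thesis
    using assms by (simp add: stiefel_cancel) (simp add: stiefel_def)
qed

lemma stiefel_square_iff_unitary:
  fixes R :: "complex ^ 'a::finite ^ 'a"
  shows "R \<in> stiefel \<longleftrightarrow> unitary_matrix R"
  by (auto simp: stiefel_def unitary_matrix_def matrix_left_right_inverse)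

lemma norm_stiefel:
  fixes X :: "complex ^ 'b::finite ^ 'a::finite"
  assumes "X \<in> stiefel"
  shows "norm X = sqrt CARD('b)"
proof -
  have "X \<bullet> X = Re (trace (mat 1 :: complex ^ 'b ^ 'b))"
    using assms by (simp add: inner_eq_Re_trace stiefel_def)
  then show ?thesis
    by (simp add: norm_eq_sqrt_inner trace_def mat_def)
qed

section \<open>Curves of unitary matrices\<close>

text \<open>
  If \<open>Y = K Y\<close>, then \<open>\<langle>Y, Y\<rangle> = \<langle>Y, K Y\<rangle>\<close>, and the latter is \<open>0\<close> because \<open>K\<close> is skew-adjoint for the real
  inner product. So left multiplication by \<open>I - K\<close> is injective on a finite-dimensional space.
\<close>

lemma skew_hermitian_resolvent:
  fixes K :: "complex ^ 'a::finite ^ 'a"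
  assumes "conj_transpose K = - K"
  obtains B where "B ** (mat 1 - K) = mat 1" "(mat 1 - K) ** B = mat 1"
proof -
  have "Y = 0" if "(mat 1 - K) ** Y = 0" for Y :: "complex ^ 'a ^ 'a"
  proof -
    have "Y = K ** Y"
      using that by (simp add: matrix_linear_simps)
    moreover have "Y \<bullet> (K ** Y) = - (Y \<bullet> (K ** Y))"
      using inner_mult_left_adjoint[of K Y Y] assms
      by (simp add: matrix_linear_simps inner_commute)
    ultimately show ?thesis
      by (metis inner_eq_zero_iff equal_neg_zero)
  qed
  then have "inj (\<lambda>Y :: complex ^ 'a ^ 'a. (mat 1 - K) ** Y)"
    by (subst linear_injective_0[OF bounded_linear.linear[OF matmul.bounded_linear_right]]) blast
  then have "surj (\<lambda>Y :: complex ^ 'a ^ 'a. (mat 1 - K) ** Y)"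
    by (rule linear_injective_imp_surjective[rotated])
      (auto intro: bounded_linear.linear matmul.bounded_linear_right)
  then obtain B where "(mat 1 - K) ** B = mat 1"
    by (metis surjD)
  then show ?thesis
    using that matrix_left_right_inverse by blast
qed

text \<open>
  Caratheodory's form of differentiability at \<open>s\<close>, for curves in a normed space.
\<close>

lemma has_vector_derivative_from_quotient:
  fixes f :: "real \<Rightarrow> 'a::real_normed_vector"
  assumes "\<And>t. f t - f s = (t - s) *\<^sub>R g t" and "isCont g s"
  shows "(f has_vector_derivative g s) (at s)"
proof -
  have "((\<lambda>t. norm (g t - g s)) \<longlongrightarrow> 0) (at s)"
    using assms(2) by (simp add: isCont_def tendsto_norm_zero_iff LIM_zero_iff)
  moreover have "\<forall>\<^sub>F t in at s. norm (g t - g s)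
      = norm (f t - f s - (t - s) *\<^sub>R g s) / norm (t - s)"
    unfolding eventually_at_filter
    by (rule always_eventually)
      (auto simp: assms(1) scaleR_diff_right[symmetric])
  ultimately have "((\<lambda>t. norm (f t - f s - (t - s) *\<^sub>R g s) / norm (t - s)) \<longlongrightarrow> 0) (at s)"
    by (rule Lim_transform_eventually)
  then show ?thesis
    by (simp add: has_vector_derivative_def has_derivative_iff_norm bounded_linear_scaleR_left)
qed

text \<open>
  Every skew-Hermitian \<open>W\<close> is the initial velocity of a \<open>C\<^sup>1\<close> curve of unitary matrices. The curve is
  the Cayley transform \<open>A(t) = (I - t K)\<^bsup>-1\<^esup> (I + t K)\<close> with \<open>K = W / 2\<close>, written as \<open>2 B(t) - I\<close> with
  \<open>B(t) = (I - t K)\<^bsup>-1\<^esup>\<close>. Being unitary bounds \<open>A\<close>, hence \<open>B\<close>, uniformly in \<open>t\<close>; the resolvent identity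
  \<open>B(t) - B(s) = (t - s) B(t) K B(s)\<close> then gives continuity of \<open>B\<close> and the derivative \<open>B K B\<close>.
\<close>

lemma unitary_curve:
  fixes W :: "complex ^ 'a::finite ^ 'a"
  assumes W: "conj_transpose W = - W"
  obtains A where "curve_at stiefel (mat 1) W A"
proof -
  define K where "K = (1/2) *\<^sub>R W"
  have K: "conj_transpose K = - K"
    using W by (simp add: K_def matrix_linear_simps)
  have "\<exists>B. B ** (mat 1 - t *\<^sub>R K) = mat 1 \<and> (mat 1 - t *\<^sub>R K) ** B = mat 1" for t
    using skew_hermitian_resolvent[of "t *\<^sub>R K"] K
    by (metis conj_transpose_linear_simps(4) scaleR_minus_right)
  then obtain B where BL: "\<And>t. B t ** (mat 1 - t *\<^sub>R K) = mat 1"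
    and BR: "\<And>t. (mat 1 - t *\<^sub>R K) ** B t = mat 1"
    by metis
  define A where "A t = 2 *\<^sub>R B t - mat 1" for t
  have A_unitary: "A t \<in> stiefel" for t
  proof -
    \<comment> \<open>\<open>B\<^sup>H\<close> inverts \<open>(I - t K)\<^sup>H = I + t K\<close>. Adding \<open>B\<^sup>H (I + t K) B\<close> and \<open>B\<^sup>H (I - t K) B\<close> gives
        \<open>2 B\<^sup>H B = B + B\<^sup>H\<close>, which is equivalent to \<open>2 B - I\<close> being unitary.\<close>
    have "conj_transpose (B t) ** (mat 1 + t *\<^sub>R K) = mat 1"
      using arg_cong[OF BR[of t], of conj_transpose] K
      by (simp add: conj_transpose_mult matrix_linear_simps)
    then have 1: "conj_transpose (B t) ** (mat 1 + t *\<^sub>R K) ** B t = B t"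
      by simp
    have 2: "conj_transpose (B t) ** (mat 1 - t *\<^sub>R K) ** B t = conj_transpose (B t)"
      by (simp add: matrix_mul_assoc[symmetric] BR)
    have "2 *\<^sub>R (conj_transpose (B t) ** B t)
        = conj_transpose (B t) ** (mat 1 + t *\<^sub>R K) ** B t
          + conj_transpose (B t) ** (mat 1 - t *\<^sub>R K) ** B t"
      by (simp add: matrix_linear_simps scaleR_2)
    also have "\<dots> = B t + conj_transpose (B t)"
      by (simp only: 1 2)
    finally have 3: "2 *\<^sub>R (conj_transpose (B t) ** B t) = B t + conj_transpose (B t)" .
    have "conj_transpose (A t) ** A t
        = 2 *\<^sub>R (2 *\<^sub>R (conj_transpose (B t) ** B t) - (B t + conj_transpose (B t))) + mat 1"
      by (simp add: A_def matrix_linear_simps scaleR_diff_right scaleR_add_right)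
    then show ?thesis
      by (simp add: 3 stiefel_def)
  qed
  have quotient: "B t - B s = (t - s) *\<^sub>R (B t ** K ** B s)" for s t
  proof -
    have "B t ** ((mat 1 - s *\<^sub>R K) - (mat 1 - t *\<^sub>R K)) ** B s
        = B t ** ((mat 1 - s *\<^sub>R K) ** B s) - (B t ** (mat 1 - t *\<^sub>R K)) ** B s"
      by (simp only: matmul.diff_left matmul.diff_right matrix_mul_assoc)
    also have "\<dots> = B t - B s"
      by (simp only: BL BR matrix_mul_lid matrix_mul_rid)
    finally show ?thesis
      by (simp add: matrix_linear_simps algebra_simps)
  qed
  define C where "C = (sqrt CARD('a) + norm (mat 1 :: complex ^ 'a ^ 'a)) / 2"
  have B_bound: "norm (B t) \<le> C" for t
  proof -
    have "B t = (1/2) *\<^sub>R (A t + mat 1)"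
      by (simp add: A_def)
    then show ?thesis
      using norm_triangle_ineq[of "A t" "mat 1"] norm_stiefel[OF A_unitary[of t]]
      by (simp add: C_def)
  qed
  obtain L where L:
    "\<And>(X :: complex ^ 'a ^ 'a) (Y :: complex ^ 'a ^ 'a). norm (X ** Y) \<le> norm X * norm Y * L"
    "L > 0"
    using matmul.pos_bounded by blast
  have B_cont: "isCont B s" for s
  proof -
    have "((\<lambda>t. \<bar>t - s\<bar> * (C * norm (K ** B s) * L)) \<longlongrightarrow> \<bar>s - s\<bar> * (C * norm (K ** B s) * L)) (at s)"
      by (intro tendsto_intros)
    then have lim: "((\<lambda>t. \<bar>t - s\<bar> * (C * norm (K ** B s) * L)) \<longlongrightarrow> 0) (at s)"
      by simp
    have "norm (B t - B s) \<le> \<bar>t - s\<bar> * (C * norm (K ** B s) * L)" for t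
    proof -
      have "norm (B t ** (K ** B s)) \<le> norm (B t) * norm (K ** B s) * L"
        by (rule L)
      also have "\<dots> \<le> C * norm (K ** B s) * L"
        using B_bound L(2) by (intro mult_right_mono) auto
      finally show ?thesis
        by (simp add: quotient[of t s] matrix_mul_assoc[symmetric] mult_left_mono)
    qed
    then have "((\<lambda>t. B t - B s) \<longlongrightarrow> 0) (at s)"
      by (intro Lim_null_comparison[OF _ lim]) simp
    then show ?thesis
      by (simp add: isCont_def LIM_zero_iff)
  qed
  have "(B has_vector_derivative B s ** K ** B s) (at s)" for s
    by (rule has_vector_derivative_from_quotient[OF quotient])
      (intro matmul.isCont B_cont continuous_const)
  then have A_deriv: "(A has_vector_derivative 2 *\<^sub>R (B s ** K ** B s)) (at s)" for s
    unfolding A_def by (auto intro!: derivative_eq_intros)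
  have "continuous_on {-1<..<1::real} (\<lambda>s. 2 *\<^sub>R (B s ** K ** B s))"
    by (intro continuous_at_imp_continuous_on ballI continuous_intros matmul.isCont B_cont)
  with A_deriv have "A C1_differentiable_on {-1<..<1}"
    unfolding C1_differentiable_on_def
    by (intro exI[of _ "\<lambda>s. 2 *\<^sub>R (B s ** K ** B s)"]) auto
  moreover have "B 0 = mat 1"
    using BL[of 0] by simp
  ultimately have "curve_at stiefel (mat 1) W A"
    unfolding curve_at_def using A_unitary A_deriv[of 0]
    by (auto intro!: exI[of _ 1] simp: A_def K_def scaleR_2)
  then show ?thesis ..
qed

section \<open>Tangent spaces of the Stiefel manifold\<close>

lemma curve_at_bounded_linear_image:
  assumes c: "curve_at M x v c" and L: "bounded_linear L" and M: "L ` M \<subseteq> N"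
  shows "curve_at N (L x) (L v) (\<lambda>t. L (c t))"
proof -
  from c obtain e D where e: "e > 0" "c ` {-e<..<e} \<subseteq> M"
    and D: "\<And>t. t \<in> {-e<..<e} \<Longrightarrow> (c has_vector_derivative D t) (at t)"
    and contD: "continuous_on {-e<..<e} D"
    and c0: "c 0 = x" "(c has_vector_derivative v) (at 0)"
    unfolding curve_at_def C1_differentiable_on_def by blast
  have "(\<lambda>t. L (c t)) C1_differentiable_on {-e<..<e}"
    unfolding C1_differentiable_on_def
    using bounded_linear.has_vector_derivative[OF L D] bounded_linear.continuous_on[OF L contD]
    by (intro exI[of _ "\<lambda>t. L (D t)"] conjI ballI)
  moreover have "(\<lambda>t. L (c t)) ` {-e<..<e} \<subseteq> N"
    using e(2) M by blast
  ultimately show ?thesis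
    unfolding curve_at_def
    using e(1) c0(1) bounded_linear.has_vector_derivative[OF L c0(2)]
    by (intro conjI exI[of _ e]) simp_all
qed

lemma curve_at_eventually:
  assumes "curve_at M x v c" "open V" "x \<in> V"
  shows "\<forall>\<^sub>F t in nhds 0. c t \<in> V \<inter> M"
proof -
  from assms(1) obtain e where e: "e > 0" "c ` {-e<..<e} \<subseteq> M"
    and c: "c 0 = x" "(c has_vector_derivative v) (at 0)"
    unfolding curve_at_def by blast
  have "isCont c 0"
    using c(2) by (rule has_vector_derivative_continuous)
  then have "\<forall>\<^sub>F t in nhds 0. c t \<in> V"
    using assms(2,3) c(1) by (auto simp: isCont_def tendsto_at_iff_tendsto_nhds
        intro: topological_tendstoD)
  moreover have "\<forall>\<^sub>F t in nhds 0. t \<in> {-e<..<e}"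
    using e(1) by (intro eventually_nhds_in_open) auto
  ultimately show ?thesis
    by eventually_elim (use e(2) in blast)
qed

lemma has_vector_derivative_transform_eventually:
  assumes "(f has_vector_derivative D) (at a)" "\<forall>\<^sub>F t in nhds a. f t = g t"
  shows "(g has_vector_derivative D) (at a)"
  using assms eventually_nhds_x_imp_x[OF assms(2)] unfolding has_vector_derivative_def
  by (intro has_derivative_transform_eventually[of f _ a UNIV g])
    (auto simp: eventually_at_filter elim: eventually_mono)

text \<open>
  Differentiating \<open>c\<^sup>H c = I\<close> gives one inclusion. For the other, \<open>S = X\<^sup>H V\<close> being skew-Hermitian makes
  \<open>W = V X\<^sup>H - X V\<^sup>H - X S X\<^sup>H\<close> a skew-Hermitian matrix with \<open>W X = V\<close>, so a curve \<open>A(t)\<close> of unitary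
  matrices with velocity \<open>W\<close> at \<open>I\<close> yields the curve \<open>A(t) X\<close> with velocity \<open>V\<close>.
\<close>

lemma tangent_space_stiefel:
  fixes X :: "complex ^ 'r::finite ^ 'n::finite"
  assumes X: "X \<in> stiefel"
  shows "tangent_space stiefel X
    = {V. conj_transpose (conj_transpose X ** V) = - (conj_transpose X ** V)}"
proof (intro equalityI subsetI CollectI)
  fix V assume "V \<in> tangent_space stiefel X"
  then obtain c where c: "curve_at stiefel X V c"
    by (auto simp: tangent_space_def)
  then have c0: "c 0 = X" "(c has_vector_derivative V) (at 0)"
    by (auto simp: curve_at_def)
  have "((\<lambda>t. conj_transpose (c t) ** c t) has_vector_derivative
      conj_transpose (c 0) ** V + conj_transpose V ** c 0) (at 0)"
    by (intro matmul.has_vector_derivative c0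
        bounded_linear.has_vector_derivative[OF bounded_linear_conj_transpose])
  moreover have "\<forall>\<^sub>F t in nhds 0. conj_transpose (c t) ** c t = mat 1"
    using curve_at_eventually[OF c open_UNIV UNIV_I]
    by eventually_elim (simp add: stiefel_def)
  ultimately have "((\<lambda>t. mat 1 :: complex ^ 'r ^ 'r) has_vector_derivative
      conj_transpose X ** V + conj_transpose V ** X) (at 0)"
    unfolding c0(1) by (rule has_vector_derivative_transform_eventually)
  then have "conj_transpose X ** V + conj_transpose V ** X = 0"
    by (rule vector_derivative_unique_at[OF _ has_vector_derivative_const])
  then show "conj_transpose (conj_transpose X ** V) = - (conj_transpose X ** V)"
    by (simp only: conj_transpose_mult conj_transpose_conj_transpose eq_neg_iff_add_eq_0
        add.commute)
next
  fix V assume "V \<in> {V. conj_transpose (conj_transpose X ** V) = - (conj_transpose X ** V)}"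
  then have V: "conj_transpose (conj_transpose X ** V) = - (conj_transpose X ** V)"
    by simp
  define S where "S = conj_transpose X ** V"
  have S: "conj_transpose S = - S"
    using V by (simp add: S_def)
  have VX: "conj_transpose V ** X = - S"
    using V by (simp add: S_def conj_transpose_mult)
  define W where "W = V ** conj_transpose X - X ** conj_transpose V - X ** S ** conj_transpose X"
  have "conj_transpose W = - W"
    by (simp add: W_def matrix_linear_simps conj_transpose_mult matrix_mul_assoc S)
  then obtain A where "curve_at stiefel (mat 1) W A"
    by (rule unitary_curve)
  then have "curve_at stiefel (mat 1 ** X) (W ** X) (\<lambda>t. A t ** X)"
    by (rule curve_at_bounded_linear_image[OF _ matmul.bounded_linear_left])
      (use X in \<open>auto intro: stiefel_mult\<close>)
  moreover have "W ** X = V"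
    using X by (simp add: W_def matrix_linear_simps matrix_mul_assoc[symmetric] VX stiefel_def)
  ultimately show "V \<in> tangent_space stiefel X"
    by (auto simp: tangent_space_def)
qed

lemma subspace_tangent_space_stiefel:
  fixes X :: "complex ^ 'r::finite ^ 'n::finite"
  assumes "X \<in> stiefel"
  shows "subspace (tangent_space stiefel X)"
  unfolding tangent_space_stiefel[OF assms] subspace_def
  by (auto simp: matrix_linear_simps matmul.zero_right
      linear_0[OF bounded_linear.linear[OF bounded_linear_conj_transpose]])

text \<open>
  The orthogonal projection onto the tangent space at \<open>X\<close>: the normal space there consists of the \<open>X H\<close>
  with \<open>H\<close> Hermitian, and the subtracted term is the normal part of \<open>Z\<close>. The formula makes sense, and is
  polynomial, on all matrices \<open>X\<close>; this is what allows differentiating it in the ambient space.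
\<close>

definition stiefel_proj ::
  "complex ^ 'r::finite ^ 'n::finite \<Rightarrow> complex ^ 'r ^ 'n \<Rightarrow> complex ^ 'r ^ 'n" where
  "stiefel_proj X Z = Z - (1/2) *\<^sub>R (X ** (conj_transpose X ** Z + conj_transpose Z ** X))"

lemma stiefel_proj_tangent:
  assumes "X \<in> stiefel"
  shows "stiefel_proj X Z \<in> tangent_space stiefel X"
proof -
  have half: "a - (1/2) *\<^sub>R (a + b) = (1/2) *\<^sub>R (a - b)" for a b :: "complex ^ 'a ^ 'a"
    by (metis scaleR_half_double scaleR_diff_right add_diff_cancel_left)
  have eq: "conj_transpose X ** stiefel_proj X Z
      = (1/2) *\<^sub>R (conj_transpose X ** Z - conj_transpose Z ** X)"
    by (simp only: stiefel_proj_def matmul.diff_right matmul.scaleR_right stiefel_cancel[OF assms] half)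
  show ?thesis
    unfolding tangent_space_stiefel[OF assms] mem_Collect_eq eq
    by (simp add: matrix_linear_simps conj_transpose_mult scaleR_diff_right)
qed

lemma stiefel_proj_orthogonal:
  assumes X: "X \<in> stiefel" and V: "V \<in> tangent_space stiefel X"
  shows "(Z - stiefel_proj X Z) \<bullet> V = 0"
proof -
  let ?H = "conj_transpose X ** Z + conj_transpose Z ** X"
  have "?H \<bullet> (conj_transpose X ** V) = 0"
    by (rule inner_hermitian_skew)
      (use V in \<open>simp_all add: tangent_space_stiefel[OF X] conj_transpose_mult matrix_linear_simps\<close>)
  then show ?thesis
    by (simp add: stiefel_proj_def inner_mult_left_adjoint)
qed

lemma orth_proj_stiefel:
  assumes "X \<in> stiefel"
  shows "orth_proj (tangent_space stiefel X) Z = stiefel_proj X Z"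
  by (rule orth_proj_eqI[OF subspace_tangent_space_stiefel[OF assms]
        stiefel_proj_tangent[OF assms] stiefel_proj_orthogonal[OF assms]])

lemma linear_stiefel_proj: "linear (stiefel_proj X)"
proof -
  have "bounded_linear (\<lambda>Z. Z - (1/2) *\<^sub>R (X ** (conj_transpose X ** Z + conj_transpose Z ** X)))"
    by (intro bounded_linear_sub bounded_linear_ident bounded_linear_const_scaleR
        bounded_linear_compose[OF matmul.bounded_linear_right] bounded_linear_add
        bounded_linear_compose[OF matmul.bounded_linear_left] bounded_linear_conj_transpose)
  then show ?thesis
    by (simp add: stiefel_proj_def[abs_def] bounded_linear.linear)
qed

section \<open>Gradient and Hessian\<close>

lemma C2_on_gradient:
  fixes f :: "'a::euclidean_space \<Rightarrow> real"
  assumes "C2_on f V"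
  obtains G where "\<forall>x\<in>V. (f has_derivative (\<lambda>v. G x \<bullet> v)) (at x)"
    and "\<forall>x\<in>V. G differentiable (at x)"
proof -
  from assms obtain f' :: "'a \<Rightarrow> 'a \<Rightarrow>\<^sub>L real" and f'' :: "'a \<Rightarrow> 'a \<Rightarrow>\<^sub>L ('a \<Rightarrow>\<^sub>L real)"
    where f': "\<And>x. x \<in> V \<Longrightarrow> (f has_derivative blinfun_apply (f' x)) (at x)"
      and f'': "\<And>x. x \<in> V \<Longrightarrow> (f' has_derivative blinfun_apply (f'' x)) (at x)"
    unfolding C2_on_def by blast
  define G where "G x = (\<Sum>b\<in>Basis. f' x b *\<^sub>R b)" for x
  have f'_eq: "blinfun_apply (f' x) = (\<lambda>v. G x \<bullet> v)" for x
  proof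
    fix v
    have "f' x v = f' x (\<Sum>b\<in>Basis. (v \<bullet> b) *\<^sub>R b)"
      by (simp add: euclidean_representation)
    also have "\<dots> = G x \<bullet> v"
      unfolding G_def blinfun.sum_right blinfun.scaleR_right inner_sum_left
      by (rule sum.cong) (simp_all add: inner_commute[of v] mult.commute)
    finally show "f' x v = G x \<bullet> v" .
  qed
  have "(f has_derivative (\<lambda>v. G x \<bullet> v)) (at x)" if "x \<in> V" for x
    using f'[OF that] by (simp only: f'_eq)
  moreover have "G differentiable (at x)" if "x \<in> V" for x
  proof -
    have "bounded_linear (\<lambda>T :: 'a \<Rightarrow>\<^sub>L real. \<Sum>b\<in>Basis. T b *\<^sub>R b)"
      by (intro bounded_linear_sum
          bounded_linear_compose[OF bounded_linear_scaleR_left blinfun.bounded_linear_left])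
    then show ?thesis
      unfolding G_def[abs_def]
      by (rule differentiableI[OF bounded_linear.has_derivative[OF _ f''[OF that]]])
  qed
  ultimately show ?thesis
    by (intro that[of G] ballI)
qed

lemma C2_on_submanifoldE:
  assumes "C2_on_submanifold M h" "x \<in> M"
  obtains V hbar where "open V" "x \<in> V" "C2_on hbar V" "\<forall>y\<in>V \<inter> M. hbar y = h y"
proof -
  have "\<exists>V hbar. open V \<and> x \<in> V \<and> C2_on hbar V \<and> (\<forall>y\<in>V \<inter> M. hbar y = h y)"
    using assms by (simp add: C2_on_submanifold_def)
  then show ?thesis
    by (elim exE conjE) (rule that)
qed

text \<open>
  The Riemannian gradient is the tangential part of the gradient of any local extension: the normal part
  is orthogonal to the velocity of every curve in the manifold. The second claim is the
  defining property of the gradient, available once the first one has exhibited the vector.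
\<close>

lemma riem_grad_stiefel:
  fixes X :: "complex ^ 'r::finite ^ 'n::finite"
  assumes X: "X \<in> stiefel" and V: "open V" "X \<in> V"
    and eq: "\<And>Y. Y \<in> V \<inter> stiefel \<Longrightarrow> hbar Y = h Y"
    and G: "(hbar has_derivative (\<lambda>v. G \<bullet> v)) (at X)"
  shows "riem_grad stiefel h X = stiefel_proj X G"
    and "curve_at stiefel X v c \<Longrightarrow>
      ((\<lambda>t. h (c t)) has_real_derivative riem_grad stiefel h X \<bullet> v) (at 0)"
proof -
  have deriv: "((\<lambda>t. h (c t)) has_real_derivative stiefel_proj X G \<bullet> v) (at 0)"
    if c: "curve_at stiefel X v c" for v c
  proof -
    from c have c0: "c 0 = X" "(c has_vector_derivative v) (at 0)"
      by (auto simp: curve_at_def)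
    have "((hbar \<circ> c) has_vector_derivative G \<bullet> v) (at 0)"
      using c0 G by (intro vector_derivative_diff_chain_within) (auto intro: has_derivative_at_withinI)
    moreover have "\<forall>\<^sub>F t in nhds 0. (hbar \<circ> c) t = h (c t)"
      using curve_at_eventually[OF c V] by eventually_elim (simp add: eq)
    ultimately have "((\<lambda>t. h (c t)) has_vector_derivative G \<bullet> v) (at 0)"
      by (rule has_vector_derivative_transform_eventually)
    moreover have "(G - stiefel_proj X G) \<bullet> v = 0"
      using c by (intro stiefel_proj_orthogonal X) (auto simp: tangent_space_def)
    ultimately show ?thesis
      by (simp add: has_real_derivative_iff_has_vector_derivative inner_diff_left)
  qed
  show grad: "riem_grad stiefel h X = stiefel_proj X G"
    by (rule riem_grad_eqI)
      (fact subspace_tangent_space_stiefel[OF X] stiefel_proj_tangent[OF X] deriv)+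
  show "((\<lambda>t. h (c t)) has_real_derivative riem_grad stiefel h X \<bullet> v) (at 0)"
    if "curve_at stiefel X v c"
    unfolding grad by (rule deriv[OF that])
qed

lemma has_derivative_along_riem_grad:
  fixes h :: "complex ^ 'r::finite ^ 'n::finite \<Rightarrow> real"
  assumes h: "C2_on_submanifold stiefel h" and X: "X \<in> stiefel"
    and c: "curve_at stiefel X v c"
  shows "((\<lambda>t. h (c t)) has_real_derivative riem_grad stiefel h X \<bullet> v) (at 0)"
proof -
  from h X obtain V hbar where V: "open V" "X \<in> V" "C2_on hbar V"
    and eq: "\<forall>Y\<in>V \<inter> stiefel. hbar Y = h Y"
    by (rule C2_on_submanifoldE)
  obtain G where "(hbar has_derivative (\<lambda>v. G X \<bullet> v)) (at X)"
    using C2_on_gradient[OF V(3)] V(2) by metis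
  from riem_grad_stiefel(2)[OF X V(1,2) bspec[OF eq] this c] show ?thesis .
qed

text \<open>
  The velocity determines the derivative of the gradient field along a curve, and does so linearly:
  near \<open>U\<close> the field is the restriction of \<open>X \<mapsto> stiefel_proj X (G X)\<close>, with \<open>G\<close> the gradient of a local
  \<open>C\<^sup>2\<close> extension, and this map is differentiable in the ambient space.
\<close>

lemma riem_grad_stiefel_derivative:
  fixes h :: "complex ^ 'r::finite ^ 'n::finite \<Rightarrow> real"
  assumes h: "C2_on_submanifold stiefel h" and U: "U \<in> stiefel"
  obtains L where "linear L"
    and "\<And>v c. curve_at stiefel U v c \<Longrightarrow>
      ((\<lambda>t. riem_grad stiefel h (c t)) has_vector_derivative L v) (at 0)"
proof -
  from h U obtain V hbar where V: "open V" "U \<in> V" "C2_on hbar V"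
    and eq: "\<forall>Y\<in>V \<inter> stiefel. hbar Y = h Y"
    by (rule C2_on_submanifoldE)
  from V(3) obtain G where G: "\<forall>X\<in>V. (hbar has_derivative (\<lambda>v. G X \<bullet> v)) (at X)"
    and G': "\<forall>X\<in>V. G differentiable (at X)"
    by (rule C2_on_gradient)
  define F where "F = (\<lambda>X. stiefel_proj X (G X))"
  have grad: "riem_grad stiefel h X = F X" if "X \<in> V \<inter> stiefel" for X
    unfolding F_def
    by (rule riem_grad_stiefel(1)[OF IntD2[OF that] V(1) IntD1[OF that] bspec[OF eq]
          bspec[OF G IntD1[OF that]]])
  obtain G1 where G1: "(G has_derivative G1) (at U)"
    using bspec[OF G' V(2)] by (auto simp: differentiable_def)
  \<comment> \<open>The product rule applied to the formula for \<open>stiefel_proj X (G X)\<close>, from the inside out.\<close>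
  note H1 = bounded_linear.has_derivative[OF bounded_linear_conj_transpose]
  note H2 = has_derivative_add[OF matmul.FDERIV[OF H1[OF has_derivative_ident] G1]
      matmul.FDERIV[OF H1[OF G1] has_derivative_ident]]
  note H3 = has_derivative_diff[OF G1
      has_derivative_scaleR_right[OF matmul.FDERIV[OF has_derivative_ident H2]]]
  have "\<exists>L. (F has_derivative L) (at U)"
    unfolding F_def stiefel_proj_def by (rule exI, rule H3)
  then obtain L where L: "(F has_derivative L) (at U)"
    by blast
  show ?thesis
  proof
    show "linear L"
      using L by (rule has_derivative_linear)
    fix v c assume c: "curve_at stiefel U v c"
    then have "c 0 = U" "(c has_vector_derivative v) (at 0)"
      by (auto simp: curve_at_def)
    then have "((F \<circ> c) has_vector_derivative L v) (at 0)"
      using L by (intro vector_derivative_diff_chain_within) (auto intro: has_derivative_at_withinI)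
    moreover have "\<forall>\<^sub>F t in nhds 0. (F \<circ> c) t = riem_grad stiefel h (c t)"
      using curve_at_eventually[OF c V(1,2)] by eventually_elim (simp add: grad)
    ultimately show "((\<lambda>t. riem_grad stiefel h (c t)) has_vector_derivative L v) (at 0)"
      by (rule has_vector_derivative_transform_eventually)
  qed
qed

lemma deriv_along_eqI:
  assumes "curve_at M x v c"
    and "\<And>c. curve_at M x v c \<Longrightarrow> ((\<lambda>t. F (c t)) has_vector_derivative w) (at 0)"
  shows "deriv_along M F x v = w"
  unfolding deriv_along_def
  by (rule the_equality) (use assms vector_derivative_unique_at in blast)+

lemma riem_hess_stiefel:
  fixes h :: "complex ^ 'r::finite ^ 'n::finite \<Rightarrow> real"
  assumes "U \<in> stiefel" and "v \<in> tangent_space stiefel U"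
    and "\<And>c. curve_at stiefel U v c \<Longrightarrow>
      ((\<lambda>t. riem_grad stiefel h (c t)) has_vector_derivative w) (at 0)"
  shows "riem_hess stiefel h U v = stiefel_proj U w"
proof -
  from assms(2) obtain c where "curve_at stiefel U v c"
    by (auto simp: tangent_space_def)
  then have "deriv_along stiefel (riem_grad stiefel h) U v = w"
    using assms(3) by (rule deriv_along_eqI)
  then show ?thesis
    by (simp add: riem_hess_def orth_proj_stiefel[OF assms(1)])
qed

lemma riem_hess_linear_on_tangent_space:
  fixes h :: "complex ^ 'r::finite ^ 'n::finite \<Rightarrow> real"
  assumes "C2_on_submanifold stiefel h" and U: "U \<in> stiefel"
  obtains H where "linear H"
    and "\<And>v. v \<in> tangent_space stiefel U \<Longrightarrow> riem_hess stiefel h U v = H v"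
proof -
  obtain L where "linear L" and L: "\<And>v c. curve_at stiefel U v c \<Longrightarrow>
      ((\<lambda>t. riem_grad stiefel h (c t)) has_vector_derivative L v) (at 0)"
    using riem_grad_stiefel_derivative[OF assms] by blast
  show ?thesis
  proof
    show "linear (stiefel_proj U \<circ> L)"
      using \<open>linear L\<close> linear_stiefel_proj by (rule linear_compose)
    show "riem_hess stiefel h U v = (stiefel_proj U \<circ> L) v"
      if "v \<in> tangent_space stiefel U" for v
      using riem_hess_stiefel[OF U that L] by simp
  qed
qed

section \<open>Unitary invariance\<close>

text \<open>
  Right multiplication by \<open>R\<^sup>H\<close> turns a curve through \<open>U R\<close> into a curve through \<open>U\<close> along which \<open>h\<close> takes
  the same values, and along curves through the stationary point \<open>U\<close> the derivative of \<open>h\<close> is \<open>0\<close>.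
\<close>

lemma stationary_point_unitary_orbit:
  fixes h :: "complex ^ 'r::finite ^ 'n::finite \<Rightarrow> real"
  assumes h: "C2_on_submanifold stiefel h" and inv: "unitarily_invariant h"
    and U: "stationary_point stiefel h U" and R: "unitary_matrix R"
  shows "riem_grad stiefel h (U ** R) = 0"
proof (rule riem_grad_eqI)
  have U': "U \<in> stiefel" "riem_grad stiefel h U = 0"
    using U by (auto simp: stationary_point_def)
  have R': "R \<in> stiefel" "conj_transpose R \<in> stiefel" "unitary_matrix (conj_transpose R)"
    using R by (auto simp: stiefel_square_iff_unitary unitary_matrix_def)
  show T: "subspace (tangent_space stiefel (U ** R))"
    using U' R' by (intro subspace_tangent_space_stiefel stiefel_mult)
  show "0 \<in> tangent_space stiefel (U ** R)"
    using T by (rule subspace_0)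
  fix v c assume c: "curve_at stiefel (U ** R) v c"
  have "curve_at stiefel (U ** R ** conj_transpose R) (v ** conj_transpose R)
      (\<lambda>t. c t ** conj_transpose R)"
    by (rule curve_at_bounded_linear_image[OF c matmul.bounded_linear_left])
      (use R' in \<open>auto intro: stiefel_mult\<close>)
  moreover have "U ** R ** conj_transpose R = U"
    using R by (simp add: unitary_matrix_def matrix_mul_assoc[symmetric])
  ultimately have c': "curve_at stiefel U (v ** conj_transpose R) (\<lambda>t. c t ** conj_transpose R)"
    by simp
  have "((\<lambda>t. h (c t ** conj_transpose R)) has_vector_derivative 0) (at 0)"
    using has_derivative_along_riem_grad[OF h U'(1) c'] U'(2)
    by (simp add: has_real_derivative_iff_has_vector_derivative)
  moreover have "\<forall>\<^sub>F t in nhds 0. h (c t ** conj_transpose R) = h (c t)"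
    using curve_at_eventually[OF c open_UNIV UNIV_I]
    by eventually_elim (use inv R' in \<open>simp add: unitarily_invariant_def\<close>)
  ultimately have "((\<lambda>t. h (c t)) has_vector_derivative 0) (at 0)"
    by (rule has_vector_derivative_transform_eventually)
  then show "((\<lambda>t. h (c t)) has_real_derivative 0 \<bullet> v) (at 0)"
    by (simp add: has_real_derivative_iff_has_vector_derivative)
qed

text \<open>
  The gradient vanishes along \<open>U A(t)\<close> for a curve of unitary matrices \<open>A(t)\<close> with velocity \<open>S\<close> at \<open>I\<close>;
  its derivative along this one curve determines the Hessian in the direction \<open>U S\<close>.
\<close>

lemma riem_hess_vertical:
  fixes h :: "complex ^ 'r::finite ^ 'n::finite \<Rightarrow> real"
  assumes h: "C2_on_submanifold stiefel h" and inv: "unitarily_invariant h"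
    and U: "stationary_point stiefel h U" and S: "conj_transpose S = - S"
  shows "U ** S \<in> tangent_space stiefel U" and "riem_hess stiefel h U (U ** S) = 0"
proof -
  have U': "U \<in> stiefel"
    using U by (simp add: stationary_point_def)
  obtain A where A: "curve_at stiefel (mat 1) S A"
    using S by (rule unitary_curve)
  have c: "curve_at stiefel U (U ** S) (\<lambda>t. U ** A t)"
    using curve_at_bounded_linear_image[OF A matmul.bounded_linear_right[of U], of stiefel] U'
    by (auto intro: stiefel_mult)
  then show T: "U ** S \<in> tangent_space stiefel U"
    by (auto simp: tangent_space_def)
  obtain L where L: "\<And>v c. curve_at stiefel U v c \<Longrightarrow>
      ((\<lambda>t. riem_grad stiefel h (c t)) has_vector_derivative L v) (at 0)"
    using riem_grad_stiefel_derivative[OF h U'] by blast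
  have "\<forall>\<^sub>F t in nhds 0. riem_grad stiefel h (U ** A t) = 0"
    using curve_at_eventually[OF A open_UNIV UNIV_I]
    by eventually_elim
      (simp add: stationary_point_unitary_orbit[OF h inv U] stiefel_square_iff_unitary)
  then have "((\<lambda>t. 0) has_vector_derivative L (U ** S)) (at 0)"
    by (rule has_vector_derivative_transform_eventually[OF L[OF c]])
  then have "L (U ** S) = 0"
    by (rule vector_derivative_unique_at[OF _ has_vector_derivative_const])
  then have "riem_hess stiefel h U (U ** S) = stiefel_proj U 0"
    using riem_hess_stiefel[OF U' T L] by simp
  then show "riem_hess stiefel h U (U ** S) = 0"
    by (simp add: linear_0[OF linear_stiefel_proj])
qed

section \<open>The rank of the Hessian\<close>

text \<open>
  The orthogonal complement of \<open>{U A | A}\<close>. For \<open>U\<close> in the Stiefel manifold it is also the orthogonal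
  complement, inside the tangent space at \<open>U\<close>, of the tangent space \<open>{U S | S skew-Hermitian}\<close> of the
  orbit of \<open>U\<close> under the unitary group.
\<close>

definition horizontal_space :: "complex ^ 'r::finite ^ 'n::finite \<Rightarrow> (complex ^ 'r ^ 'n) set" where
  "horizontal_space U = {V. conj_transpose U ** V = 0}"

lemma subspace_horizontal_space: "subspace (horizontal_space U)"
  by (simp add: horizontal_space_def subspace_def matmul.zero_right matmul.add_right
      matmul.scaleR_right)

lemma dim_horizontal_space:
  fixes U :: "complex ^ 'r::finite ^ 'n::finite"
  assumes U: "U \<in> stiefel"
  shows "dim (horizontal_space U) \<le> 2 * CARD('r) * (CARD('n) - CARD('r))"
proof -
  let ?R = "range (\<lambda>A :: complex ^ 'r ^ 'r. U ** A)"
  have lin: "linear (\<lambda>A :: complex ^ 'r ^ 'r. U ** A)"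
    by (intro bounded_linear.linear matmul.bounded_linear_right)
  have "inj (\<lambda>A :: complex ^ 'r ^ 'r. U ** A)"
    by (rule inj_on_inverseI[where g = "\<lambda>Y. conj_transpose U ** Y"]) (simp add: stiefel_cancel[OF U])
  then have "dim ?R = dim (UNIV :: (complex ^ 'r ^ 'r) set)"
    by (intro dim_image_eq[OF lin]) (auto intro: inj_on_subset)
  then have R: "dim ?R = 2 * CARD('r) * CARD('r)"
    by simp
  have "horizontal_space U \<inter> ?R \<subseteq> {0}"
    by (auto simp: horizontal_space_def stiefel_cancel[OF U] matmul.zero_right)
  then have "dim (horizontal_space U \<inter> ?R) = 0"
    by (simp only: dim_eq_0)
  moreover have "subspace ?R"
    using lin by (rule linear_subspace_image) simp
  ultimately have "dim (horizontal_space U) + dim ?R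
      = dim {x + y |x y. x \<in> horizontal_space U \<and> y \<in> ?R}"
    using dim_sums_Int[OF subspace_horizontal_space, of ?R U] by linarith
  also have "\<dots> \<le> DIM(complex ^ 'r ^ 'n)"
    by (rule dim_subset_UNIV)
  finally have "dim (horizontal_space U) + 2 * CARD('r) * CARD('r) \<le> 2 * CARD('r) * CARD('n)"
    by (simp add: R ac_simps)
  then show ?thesis
    by (simp add: diff_mult_distrib2)
qed

lemma conj_transpose_Omega: "conj_transpose (Omega p q) = - Omega p q"
  by (auto simp: conj_transpose_def Omega_def outer_def map_matrix_def axis_def vec_eq_iff)

lemma conj_transpose_Omega': "conj_transpose (Omega' p q) = - Omega' p q"
  by (auto simp: conj_transpose_def Omega'_def outer_def axis_def vec_eq_iff)

theorem lemma2p3: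
  fixes h :: "complex ^ 'r::{finite,linorder} ^ 'n::finite \<Rightarrow> real"
    and U :: "complex ^ 'r::{finite,linorder} ^ 'n::finite"
  assumes "CARD('r) \<le> CARD('n)"
    and "C2_on_submanifold stiefel h"
    and "unitarily_invariant h"
    and "stationary_point stiefel h U"
  shows "(\<forall>p q :: 'r. p < q \<longrightarrow>
            riem_hess stiefel h U (U ** Omega p q) = 0 \<and>
            riem_hess stiefel h U (U ** Omega' p q) = 0) \<and>
         dim (riem_hess stiefel h U ` tangent_space stiefel U) \<le> 2 * CARD('r) * (CARD('n) - CARD('r))"
proof (intro conjI allI impI)
  note vertical = riem_hess_vertical[OF assms(2-4)]
  show "riem_hess stiefel h U (U ** Omega p q) = 0" for p q
    by (rule vertical(2)[OF conj_transpose_Omega])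
  show "riem_hess stiefel h U (U ** Omega' p q) = 0" for p q
    by (rule vertical(2)[OF conj_transpose_Omega'])
  have U: "U \<in> stiefel"
    using assms(4) by (simp add: stationary_point_def)
  obtain H where H: "linear H"
    and hess: "\<And>v. v \<in> tangent_space stiefel U \<Longrightarrow> riem_hess stiefel h U v = H v"
    using riem_hess_linear_on_tangent_space[OF assms(2) U] by blast
  have "riem_hess stiefel h U v \<in> H ` horizontal_space U" if v: "v \<in> tangent_space stiefel U" for v
  proof
    \<comment> \<open>Only the horizontal part of \<open>v\<close> contributes.\<close>
    let ?S = "conj_transpose U ** v"
    have S: "conj_transpose ?S = - ?S"
      using v by (simp add: tangent_space_stiefel[OF U])
    show "v - U ** ?S \<in> horizontal_space U"
      by (simp add: horizontal_space_def matmul.diff_right stiefel_cancel[OF U])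
    have "H (U ** ?S) = 0"
      using hess[OF vertical(1)[OF S]] vertical(2)[OF S] by simp
    then show "riem_hess stiefel h U v = H (v - U ** ?S)"
      by (simp add: hess[OF v] linear_diff[OF H])
  qed
  then have "dim (riem_hess stiefel h U ` tangent_space stiefel U) \<le> dim (H ` horizontal_space U)"
    by (intro dim_subset) blast
  also have "\<dots> \<le> dim (horizontal_space U)"
    by (rule dim_image_le[OF H])
  also have "\<dots> \<le> 2 * CARD('r) * (CARD('n) - CARD('r))"
    by (rule dim_horizontal_space[OF U])
  finally show "dim (riem_hess stiefel h U ` tangent_space stiefel U)
      \<le> 2 * CARD('r) * (CARD('n) - CARD('r))" .
qed

end
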